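(* Let $(X,\preceq)$ be a locally compact and order-connected topological poset. Then the map $x^{\downarrow}\mapsto x$ from $\mathcal{C}_{\downarrow}(X):=\{x^{\downarrow}:x\in X\}$ onto $X$ is continuous, where $\mathcal{C}_{\downarrow}(X)$ carries the relative Fell topology inherited from $\mathcal{C}(X)$.
   Context: A topological poset is a poset $(X,\preceq)$ with $X$ a nonempty topological space such that $\preceq$ is a closed subset of $X\times X$ (product topology); such an $X$ is automatically Hausdorff. It is locally compact if $X$ is. For $x\in X$, $x^{\downarrow}:=\{z\in X:z\preceq x\}$ and $x^{\uparrow}:=\{z\in X:x\preceq z\}$. The poset is order-connected if $x^{\uparrow}\cap y^{\downarrow}$ is a connected subset of $X$ for all $x,y\in X$ with $x\preceq y$. $\mathcal{C}(X)$ is the set of all closed subsets of $X$ (including $\varnothing$). The Fell topology on $\mathcal{C}(X)$ is the topology generated (as a subbase) by all sets $\{A\in\mathcal{C}(X):A\cap O\neq\varnothing\}$ with $O\subseteq X$ open, and all sets $\{A\in\mathcal{C}(X):A\subseteq X\setminus K\}$ with $K\subseteq X$ compact. *)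

theory Defs
  imports "HOL-Analysis.Analysis"
begin

text \<open>The space and the order are relative to a carrier: the points are \<open>topspace X\<close>, and
  \<open>(x, y) \<in> r\<close> means that \<open>x\<close> is below or equal to \<open>y\<close>.\<close>

definition topological_poset :: "'a topology \<Rightarrow> ('a \<times> 'a) set \<Rightarrow> bool" where
  "topological_poset X r \<longleftrightarrow>
     topspace X \<noteq> {} \<and> partial_order_on (topspace X) r \<and> closedin (prod_topology X X) r"

definition down_set :: "'a topology \<Rightarrow> ('a \<times> 'a) set \<Rightarrow> 'a \<Rightarrow> 'a set" where
  "down_set X r x = {z \<in> topspace X. (z, x) \<in> r}"

definition up_set :: "'a topology \<Rightarrow> ('a \<times> 'a) set \<Rightarrow> 'a \<Rightarrow> 'a set" where
  "up_set X r x = {z \<in> topspace X. (x, z) \<in> r}"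

definition order_connected :: "'a topology \<Rightarrow> ('a \<times> 'a) set \<Rightarrow> bool" where
  "order_connected X r \<longleftrightarrow>
     (\<forall>x \<in> topspace X. \<forall>y \<in> topspace X.
        (x, y) \<in> r \<longrightarrow> connectedin X (up_set X r x \<inter> down_set X r y))"

definition closed_sets :: "'a topology \<Rightarrow> 'a set set" where
  "closed_sets X = {A. closedin X A}"

definition fell_topology :: "'a topology \<Rightarrow> 'a set topology" where
  "fell_topology X = topology_generated_by
     ({{A \<in> closed_sets X. A \<inter> U \<noteq> {}} | U. openin X U} \<union>
      {{A \<in> closed_sets X. A \<subseteq> topspace X - K} | K. compactin X K})"

definition principal_down_sets :: "'a topology \<Rightarrow> ('a \<times> 'a) set \<Rightarrow> 'a set set" where
  "principal_down_sets X r = {down_set X r x | x. x \<in> topspace X}"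

text \<open>The inverse of \<open>x \<mapsto> down_set X r x\<close> on \<open>topspace X\<close>; that map is injective for a topological
  poset, see \<open>generator_down_set\<close> and \<open>bij_betw_generator\<close> below.\<close>

definition generator :: "'a topology \<Rightarrow> ('a \<times> 'a) set \<Rightarrow> 'a set \<Rightarrow> 'a" where
  "generator X r = the_inv_into (topspace X) (down_set X r)"

lemma topspace_fell_topology [simp]: "topspace (fell_topology X) = closed_sets X"
proof -
  have "{A \<in> closed_sets X. A \<subseteq> topspace X - {}} = closed_sets X"
    by (auto simp: closed_sets_def dest: closedin_subset)
  moreover have "compactin X {}" by simp
  ultimately have "closed_sets X \<in> {{A \<in> closed_sets X. A \<subseteq> topspace X - K} | K. compactin X K}"
    by blast
  then show ?thesis
    unfolding fell_topology_def topology_generated_by_topspace by blast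
qed

lemma closedin_down_set:
  assumes "topological_poset X r" "x \<in> topspace X"
  shows "closedin X (down_set X r x)"
proof -
  have "continuous_map X (prod_topology X X) (\<lambda>z. (z, x))"
    using assms(2) by (simp add: continuous_map_pairwise o_def)
  moreover have "closedin (prod_topology X X) r"
    using assms(1) by (simp add: topological_poset_def)
  ultimately show ?thesis
    unfolding down_set_def by (rule closedin_continuous_map_preimage)
qed

lemma inj_on_down_set:
  assumes "topological_poset X r"
  shows "inj_on (down_set X r) (topspace X)"
proof (rule inj_onI)
  fix x y assume xy: "x \<in> topspace X" "y \<in> topspace X" "down_set X r x = down_set X r y"
  have r: "refl_on (topspace X) r" "antisym r"
    using assms by (auto simp: topological_poset_def partial_order_on_def preorder_on_def)
  then have "x \<in> down_set X r x" "y \<in> down_set X r y"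
    using xy by (auto simp: down_set_def refl_on_def)
  then have "(x, y) \<in> r" "(y, x) \<in> r"
    using xy(3) by (auto simp: down_set_def)
  then show "x = y" using r(2) by (auto dest: antisymD)
qed

lemma generator_down_set:
  assumes "topological_poset X r" "x \<in> topspace X"
  shows "generator X r (down_set X r x) = x"
  unfolding generator_def using inj_on_down_set[OF assms(1)] assms(2) by (rule the_inv_into_f_f)

lemma bij_betw_generator:
  assumes "topological_poset X r"
  shows "bij_betw (generator X r) (principal_down_sets X r) (topspace X)"
proof -
  have "principal_down_sets X r = down_set X r ` topspace X"
    by (auto simp: principal_down_sets_def)
  then show ?thesis
    unfolding generator_def
    by (simp add: bij_betw_the_inv_into inj_on_imp_bij_betw inj_on_down_set[OF assms])
qed

lemma principal_down_sets_subset: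
  assumes "topological_poset X r"
  shows "principal_down_sets X r \<subseteq> closed_sets X"
  using closedin_down_set[OF assms] by (auto simp: principal_down_sets_def closed_sets_def)

end

theory Submission
  imports Defs
begin

text \<open>Let \<open>x\<close> be a point and \<open>W\<close> a neighbourhood of it. The lemma \<open>fell_neighbourhood\<close> provides
  an open \<open>U\<close> containing \<open>x\<close> and a compact \<open>K\<close> missing \<open>x\<^sup>\<down>\<close> such that every \<open>y\<close> whose down-set
  meets \<open>U\<close> and misses \<open>K\<close> lies in \<open>W\<close>; as hitting \<open>U\<close> and missing \<open>K\<close> are subbasic Fell
  conditions, this is continuity at \<open>x\<^sup>\<down>\<close>.

  The set \<open>K\<close> is a barrier. Let \<open>V \<subseteq> C \<subseteq> W\<close> be a neighbourhood of \<open>x\<close> with \<open>V\<close> open and \<open>C\<close>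
  compact. If \<open>z \<in> V\<close> lies below some \<open>y \<notin> C\<close>, then the order interval from \<open>z\<close> to \<open>y\<close> is
  connected, so it cannot jump from \<open>V\<close> to the complement of \<open>C\<close> and must contain a point \<open>w\<close> of
  the compact shell \<open>C - V\<close>. This \<open>w\<close> belongs to \<open>y\<^sup>\<down>\<close>, so prohibiting \<open>C - V\<close> would confine \<open>y\<close>
  to \<open>C\<close>. However, \<open>x\<^sup>\<down>\<close> itself may meet the shell, so only the part of the shell above the
  points \<open>z\<close> that are allowed to occur may be prohibited. Shell points below \<open>x\<close> are not above
  \<open>x\<close>, by antisymmetry, and they form a compact set; since the order is closed and projection
  along a compact set preserves closedness (\<open>closedin_Image_compactin\<close>), they are not above any
  point of a whole compact neighbourhood \<open>D\<close> of \<open>x\<close> either. The part of the shell above \<open>D\<close> is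
  then the required \<open>K\<close>, again compact by projection, and \<open>U\<close> is an open neighbourhood of
  \<open>x\<close> inside \<open>D\<close>.\<close>

text \<open>The image is the projection of a closed subset of \<open>C \<times> Y\<close>, and projection along a compact
  factor is a closed map.\<close>

lemma closedin_Image_compactin:
  assumes R: "closedin (prod_topology X Y) R" and C: "compactin X C"
  shows "closedin Y (R `` C)"
proof -
  let ?S = "R \<inter> (C \<times> topspace Y)"
  have "closedin (prod_topology (subtopology X C) Y) ?S"
    using R by (auto simp: prod_topology_subtopology(1) closedin_subtopology)
  moreover have "closed_map (prod_topology (subtopology X C) Y) Y snd"
    using C by (simp add: closed_map_snd compact_space_subtopology)
  ultimately have "closedin Y (snd ` ?S)"
    by (simp add: closed_map_def)
  moreover have "snd ` ?S = R `` C"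
    using closedin_subset[OF R] by force
  ultimately show ?thesis by simp
qed

lemma closedin_converse:
  assumes "closedin (prod_topology X Y) R"
  shows "closedin (prod_topology Y X) (R\<inverse>)"
proof -
  have "closed_map (prod_topology X Y) (prod_topology Y X) (\<lambda>(x, y). (y, x))"
    using homeomorphic_map_swap by (rule homeomorphic_imp_closed_map)
  then have "closedin (prod_topology Y X) ((\<lambda>(x, y). (y, x)) ` R)"
    using assms by (simp add: closed_map_def)
  moreover have "(\<lambda>(x, y). (y, x)) ` R = R\<inverse>"
    by force
  ultimately show ?thesis by simp
qed

lemma topological_posetD:
  assumes "topological_poset X r"
  shows "\<And>x. x \<in> topspace X \<Longrightarrow> (x, x) \<in> r"
    and "\<And>x y. \<lbrakk>(x, y) \<in> r; (y, x) \<in> r\<rbrakk> \<Longrightarrow> x = y"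
    and "\<And>x y. (x, y) \<in> r \<Longrightarrow> x \<in> topspace X \<and> y \<in> topspace X"
    and "closedin (prod_topology X X) r"
  using assms closedin_subset[of "prod_topology X X" r]
  by (auto simp: topological_poset_def partial_order_on_def preorder_on_def
      dest: refl_onD antisymD)

text \<open>By reflexivity and antisymmetry the diagonal is the intersection of the order with its
  converse, hence closed.\<close>

lemma topological_poset_imp_Hausdorff_space:
  assumes "topological_poset X r"
  shows "Hausdorff_space X"
proof -
  have "(\<lambda>x. (x, x)) ` topspace X = r \<inter> r\<inverse>"
    using topological_posetD(1-3)[OF assms] by auto
  then show ?thesis
    using topological_posetD(4)[OF assms]
    by (simp add: Hausdorff_space_closedin_diagonal closedin_Int closedin_converse)
qed

lemma openin_fell_topology_hit:
  assumes "openin X U"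
  shows "openin (fell_topology X) {A \<in> closed_sets X. A \<inter> U \<noteq> {}}"
  unfolding fell_topology_def using assms by (intro topology_generated_by_Basis) blast

lemma openin_fell_topology_miss:
  assumes "compactin X K"
  shows "openin (fell_topology X) {A \<in> closed_sets X. A \<subseteq> topspace X - K}"
  unfolding fell_topology_def using assms by (intro topology_generated_by_Basis) blast

text \<open>Otherwise \<open>V\<close> and the complement of \<open>C\<close>, which are disjoint and open, would separate the
  order interval between its endpoints.\<close>

lemma order_interval_meets_shell:
  assumes "topological_poset X r" and "order_connected X r"
    and V: "openin X V" and C: "closedin X C" and "V \<subseteq> C"
    and zy: "(z, y) \<in> r" and "z \<in> V" and "y \<notin> C"
  obtains w where "w \<in> C - V" "(z, w) \<in> r" "(w, y) \<in> r"
proof -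
  note poset = topological_posetD[OF assms(1)]
  let ?I = "up_set X r z \<inter> down_set X r y"
  have top: "z \<in> topspace X" "y \<in> topspace X"
    using poset(3)[OF zy] by auto
  then have I: "connectedin X ?I" "z \<in> ?I" "y \<in> ?I"
    using assms(2) zy poset(1) by (auto simp: order_connected_def up_set_def down_set_def)
  have "?I \<inter> (C - V) \<noteq> {}"
  proof
    assume "?I \<inter> (C - V) = {}"
    moreover have "?I \<subseteq> topspace X"
      by (auto simp: up_set_def)
    ultimately have "?I \<subseteq> V \<union> (topspace X - C)"
      by blast
    moreover have "openin X (topspace X - C)"
      using C by blast
    moreover have "V \<inter> (topspace X - C) \<inter> ?I = {}"
      using \<open>V \<subseteq> C\<close> by blast
    moreover have "V \<inter> ?I \<noteq> {}" "(topspace X - C) \<inter> ?I \<noteq> {}"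
      using I(2,3) top \<open>z \<in> V\<close> \<open>y \<notin> C\<close> by blast+
    ultimately show False
      using connectedinD[OF I(1) V] by blast
  qed
  then show thesis
    using that by (auto simp: up_set_def down_set_def)
qed

text \<open>This is the continuity at \<open>x\<^sup>\<down>\<close>, expressed by points instead of closed sets. The compact
  neighbourhood \<open>D\<close> is needed besides \<open>U\<close> because the up-closure of \<open>U\<close> need not be closed.\<close>

lemma fell_neighbourhood:
  assumes "topological_poset X r" and "locally_compact_space X" and "order_connected X r"
    and W: "openin X W" and x: "x \<in> W"
  obtains U K where "openin X U" "compactin X K" "x \<in> U" "down_set X r x \<inter> K = {}"
    "\<And>y. \<lbrakk>down_set X r y \<inter> U \<noteq> {}; down_set X r y \<inter> K = {}\<rbrakk> \<Longrightarrow> y \<in> W"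
proof -
  note poset = topological_posetD[OF assms(1)]
  have "neighbourhood_base_of (\<lambda>C. compactin X C \<and> closedin X C) X"
    using assms(2) topological_poset_imp_Hausdorff_space[OF assms(1)]
    by (simp add: locally_compact_space_neighbourhood_base_closedin)
  then have base: "\<exists>V C. openin X V \<and> (compactin X C \<and> closedin X C) \<and> p \<in> V \<and> V \<subseteq> C \<and> C \<subseteq> O'"
    if "openin X O'" "p \<in> O'" for O' p
    using that by (simp add: neighbourhood_base_of)
  obtain V C where VC: "openin X V" "compactin X C" "closedin X C" "x \<in> V" "V \<subseteq> C" "C \<subseteq> W"
    using base[OF W x] by blast
  have xX: "x \<in> topspace X"
    using W x openin_subset by blast
  define S where "S = C - V"
  have S: "compactin X S"
    unfolding S_def using VC by (metis closed_compactin closedin_diff Diff_subset)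
  \<comment> \<open>A set \<open>D\<close> that avoids \<open>B\<close> has no shell point of \<open>x\<^sup>\<down>\<close> above it, so that \<open>K\<close> misses \<open>x\<^sup>\<down>\<close>.\<close>
  define B where "B = r\<inverse> `` (S \<inter> down_set X r x)"
  have "compactin X (S \<inter> down_set X r x)"
    using S closedin_down_set[OF assms(1) xX] by (rule compact_Int_closedin)
  then have "closedin X B"
    unfolding B_def by (rule closedin_Image_compactin[OF closedin_converse[OF poset(4)]])
  have "x \<notin> B"
    using poset(2) VC(4) by (auto simp: B_def S_def down_set_def)
  have "openin X (V - B)"
    using VC(1) \<open>closedin X B\<close> by (rule openin_diff)
  then obtain U D where UD: "openin X U" "compactin X D" "x \<in> U" "U \<subseteq> D" "D \<subseteq> V - B"
    using base[of "V - B" x] VC(4) \<open>x \<notin> B\<close> by blast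
  define K where "K = S \<inter> r `` D"
  show thesis
  proof
    show "openin X U" "x \<in> U"
      using UD by auto
    show "compactin X K"
      unfolding K_def using S closedin_Image_compactin[OF poset(4) UD(2)] by (rule compact_Int_closedin)
    show "down_set X r x \<inter> K = {}"
      using UD(5) by (auto simp: K_def B_def)
    fix y assume y: "down_set X r y \<inter> U \<noteq> {}" "down_set X r y \<inter> K = {}"
    then obtain z where z: "z \<in> U" "(z, y) \<in> r"
      by (auto simp: down_set_def)
    show "y \<in> W"
    proof (rule ccontr)
      assume "y \<notin> W"
      then have "y \<notin> C" "z \<in> V"
        using VC(6) z(1) UD(4,5) by auto
      then obtain w where w: "w \<in> C - V" "(z, w) \<in> r" "(w, y) \<in> r"
        using order_interval_meets_shell[OF assms(1,3) VC(1,3,5) z(2)] by metis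
      then have "w \<in> down_set X r y \<inter> K"
        using z(1) UD(4) poset(3) by (auto simp: K_def S_def down_set_def)
      then show False
        using y(2) by blast
    qed
  qed
qed

theorem theorem12:
  fixes X :: "'a topology" and r :: "('a \<times> 'a) set"
  assumes "topological_poset X r"
    and "locally_compact_space X"
    and "order_connected X r"
  shows "continuous_map (subtopology (fell_topology X) (principal_down_sets X r)) X (generator X r) \<and>
         generator X r ` principal_down_sets X r = topspace X"
proof
  let ?P = "principal_down_sets X r"
  let ?F = "subtopology (fell_topology X) ?P"
  show surj: "generator X r ` ?P = topspace X"
    using bij_betw_generator[OF assms(1)] by (simp add: bij_betw_def)
  have topF: "topspace ?F = ?P"
    using principal_down_sets_subset[OF assms(1)] by auto
  show "continuous_map ?F X (generator X r)"
    unfolding continuous_map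
  proof (intro conjI allI impI)
    show "generator X r ` topspace ?F \<subseteq> topspace X"
      by (simp only: topF surj)
    fix W assume W: "openin X W"
    show "openin ?F {A \<in> topspace ?F. generator X r A \<in> W}"
      unfolding topF
    proof (subst openin_subopen, intro ballI)
      fix A assume "A \<in> {A \<in> ?P. generator X r A \<in> W}"
      then obtain x where x: "x \<in> topspace X" "A = down_set X r x" "x \<in> W"
        by (auto simp: principal_down_sets_def generator_down_set[OF assms(1)])
      obtain U K where UK: "openin X U" "compactin X K" "x \<in> U" "down_set X r x \<inter> K = {}"
        "\<And>y. \<lbrakk>down_set X r y \<inter> U \<noteq> {}; down_set X r y \<inter> K = {}\<rbrakk> \<Longrightarrow> y \<in> W"
        using fell_neighbourhood[OF assms W x(3)] by metis
      let ?N = "{A \<in> closed_sets X. A \<inter> U \<noteq> {}} \<inter> {A \<in> closed_sets X. A \<subseteq> topspace X - K} \<inter> ?P"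
      have "openin ?F ?N"
        using UK(1,2)
        by (intro openin_subtopology_Int openin_Int openin_fell_topology_hit openin_fell_topology_miss)
      moreover have "x \<in> down_set X r x"
        using x(1) topological_posetD(1)[OF assms(1)] by (simp add: down_set_def)
      then have "A \<in> ?N"
        using x UK(3,4) closedin_down_set[OF assms(1) x(1)]
        by (auto simp: closed_sets_def principal_down_sets_def down_set_def)
      moreover have "?N \<subseteq> {A \<in> ?P. generator X r A \<in> W}"
      proof
        fix B assume B: "B \<in> ?N"
        then obtain y where y: "y \<in> topspace X" "B = down_set X r y"
          by (auto simp: principal_down_sets_def)
        then have "y \<in> W"
          using B by (intro UK(5)) blast+
        then show "B \<in> {A \<in> ?P. generator X r A \<in> W}"
          using B y generator_down_set[OF assms(1) y(1)] by simp
      qed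
      ultimately show "\<exists>T. openin ?F T \<and> A \<in> T \<and> T \<subseteq> {A \<in> ?P. generator X r A \<in> W}"
        by blast
    qed
  qed
qed

end
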